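(* Let $(X,\mathcal{A})$ be a measurable space, let $S(X,\mathcal{A})$ be a $\chi$-ring, and let $\mathcal{U}$ be an $\mathcal{A}$-ultrafilter on $X$. Then there exists a maximal ideal $M$ in $S(X,\mathcal{A})$ such that $\mathcal{Z}_S[M]=\mathcal{U}$.
   Context: A measurable space $(X,\mathcal{A})$ is a nonempty set $X$ with a $\sigma$-algebra $\mathcal{A}$ of subsets of $X$. $\mathcal{M}(X,\mathcal{A})$ is the commutative ring (pointwise operations) of all $\mathcal{A}$-measurable functions $X\to\mathbb{R}$. A $\chi$-ring $S(X,\mathcal{A})$ is a subring of $\mathcal{M}(X,\mathcal{A})$ such that $\chi_A\in S(X,\mathcal{A})$ for every $A\in\mathcal{A}$, where $\chi_A$ is the characteristic function of $A$. "Ideal" always means proper ideal. For $f\in S(X,\mathcal{A})$, $\mathcal{Z}_S(f)=\{E\in\mathcal{A}: \text{there exists } g\in S(X,\mathcal{A}) \text{ with } f(x)g(x)=1 \text{ for all } x\in X\setminus E\}$; for an ideal $I$, $\mathcal{Z}_S[I]=\bigcup_{f\in I}\mathcal{Z}_S(f)$. An $\mathcal{A}$-filter on $X$ is a nonempty family of members of $\mathcal{A}$ not containing $\emptyset$, closed under finite intersections and under supersets belonging to $\mathcal{A}$; an $\mathcal{A}$-ultrafilter is a maximal $\mathcal{A}$-filter. *)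

theory Defs
  imports "HOL-Analysis.Analysis" "HOL-Algebra.Ideal" "HOL-Algebra.Subrings"
begin

text \<open>A measurable space is represented by a \<^typ>\<open>'a measure\<close>, of which only
  \<^const>\<open>space\<close> and \<^const>\<open>sets\<close> are used. Functions on the space are taken to be
  extensional, so that two functions are equal iff they agree on the space.\<close>

definition meas_ring :: "'a measure \<Rightarrow> ('a \<Rightarrow> real) ring" where
  "meas_ring M =
    \<lparr> carrier = borel_measurable M \<inter> extensional (space M),
      mult = (\<lambda>f g. \<lambda>x\<in>space M. f x * g x),
      one = (\<lambda>x\<in>space M. 1),
      zero = (\<lambda>x\<in>space M. 0),
      add = (\<lambda>f g. \<lambda>x\<in>space M. f x + g x) \<rparr>"

definition char_fun :: "'a measure \<Rightarrow> 'a set \<Rightarrow> 'a \<Rightarrow> real" where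
  "char_fun M A = (\<lambda>x\<in>space M. indicator A x)"

definition chi_ring :: "'a measure \<Rightarrow> ('a \<Rightarrow> real) set \<Rightarrow> bool" where
  "chi_ring M S \<longleftrightarrow> subring S (meas_ring M) \<and> (\<forall>A\<in>sets M. char_fun M A \<in> S)"

abbreviation chi_ring_struct :: "'a measure \<Rightarrow> ('a \<Rightarrow> real) set \<Rightarrow> ('a \<Rightarrow> real) ring" where
  "chi_ring_struct M S \<equiv> (meas_ring M)\<lparr>carrier := S\<rparr>"

definition Z_fun :: "'a measure \<Rightarrow> ('a \<Rightarrow> real) set \<Rightarrow> ('a \<Rightarrow> real) \<Rightarrow> 'a set set" where
  "Z_fun M S f = {E \<in> sets M. \<exists>g\<in>S. \<forall>x\<in>space M - E. f x * g x = 1}"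

definition Z_ideal :: "'a measure \<Rightarrow> ('a \<Rightarrow> real) set \<Rightarrow> ('a \<Rightarrow> real) set \<Rightarrow> 'a set set" where
  "Z_ideal M S I = (\<Union>f\<in>I. Z_fun M S f)"

definition meas_filter :: "'a measure \<Rightarrow> 'a set set \<Rightarrow> bool" where
  "meas_filter M F \<longleftrightarrow>
    F \<subseteq> sets M \<and> F \<noteq> {} \<and> {} \<notin> F \<and>
    (\<forall>A\<in>F. \<forall>B\<in>F. A \<inter> B \<in> F) \<and>
    (\<forall>A\<in>F. \<forall>B\<in>sets M. A \<subseteq> B \<longrightarrow> B \<in> F)"

definition meas_ultrafilter :: "'a measure \<Rightarrow> 'a set set \<Rightarrow> bool" where
  "meas_ultrafilter M U \<longleftrightarrow>
    meas_filter M U \<and> (\<forall>F. meas_filter M F \<and> U \<subseteq> F \<longrightarrow> F = U)"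

lemma cring_meas_ring: "cring (meas_ring M)"
proof (rule cringI)
  show "abelian_group (meas_ring M)"
  proof (rule abelian_groupI)
    fix f assume "f \<in> carrier (meas_ring M)"
    then show "\<exists>g\<in>carrier (meas_ring M). g \<oplus>\<^bsub>meas_ring M\<^esub> f = \<zero>\<^bsub>meas_ring M\<^esub>"
      by (intro bexI[of _ "\<lambda>x\<in>space M. - f x"])
        (auto simp: meas_ring_def fun_eq_iff measurable_restrict_space1 cong: measurable_cong)
  qed (auto simp: meas_ring_def fun_eq_iff extensional_def cong: measurable_cong)
  show "Group.comm_monoid (meas_ring M)"
    by (rule comm_monoidI)
      (auto simp: meas_ring_def fun_eq_iff extensional_def cong: measurable_cong)
qed (auto simp: meas_ring_def fun_eq_iff algebra_simps)

lemma cring_chi_ring_struct: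
  assumes "chi_ring M S"
  shows "cring (chi_ring_struct M S)"
proof -
  interpret cring "meas_ring M" by (rule cring_meas_ring)
  have "subring S (meas_ring M)" using assms by (simp add: chi_ring_def)
  then show ?thesis
    by (intro subcring_iff[THEN iffD1] subcringI') (auto dest: subringE(1))
qed

end

theory Submission
  imports Defs "HOL-Algebra.Ring_Divisibility"
begin

text \<open>The functions in \<open>S\<close> that vanish on some member of \<open>U\<close> form a proper ideal, and any maximal
  ideal \<open>I\<close> above it will do. If \<open>E \<in> U\<close>, then the characteristic function of the complement of
  \<open>E\<close> lies in \<open>I\<close> and is its own inverse off \<open>E\<close>. Conversely, let \<open>f \<in> I\<close> be inverted by \<open>g\<close> off
  \<open>E\<close>. If \<open>E \<notin> U\<close>, then the complement of \<open>E\<close> is in \<open>U\<close>, so the characteristic function \<open>c\<close> of \<open>E\<close>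
  lies in \<open>I\<close>, and then so does \<open>1 = c + f g (1 - c)\<close>, a contradiction.\<close>

text \<open>Zorn's lemma applies to the ideals above \<open>I\<close> that miss
  \<open>\<one>\<close>, since the union of a nonempty chain of them still misses
  \<open>\<one>\<close>. A maximal element is a maximal ideal because any ideal containing
  \<open>\<one>\<close> is the whole ring.\<close>

lemma (in ring) exists_maximalideal_superset:
  assumes I: "ideal I R" and one: "\<one> \<notin> I"
  obtains J where "maximalideal J R" "I \<subseteq> J"
proof -
  define P where "P = {J. ideal J R \<and> I \<subseteq> J \<and> \<one> \<notin> J}"
  have "\<exists>J\<in>P. \<forall>X\<in>P. J \<subseteq> X \<longrightarrow> X = J"
  proof (rule subset_Zorn_nonempty)
    show "P \<noteq> {}" using I one by (auto simp: P_def)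
  next
    fix C assume ne: "C \<noteq> {}" and ch: "subset.chain P C"
    have CP: "C \<subseteq> P" using ch by (simp add: pred_on.chain_def)
    have "subset.chain {J. ideal J R} C"
      using ch by (auto simp: pred_on.chain_def P_def)
    from chain_Union_is_ideal[OF this] have "ideal (\<Union>C) R" using ne by simp
    then show "\<Union>C \<in> P" using CP ne by (auto simp: P_def)
  qed
  then obtain J where J: "ideal J R" "I \<subseteq> J" "\<one> \<notin> J"
    and max: "\<And>X. X \<in> P \<Longrightarrow> J \<subseteq> X \<Longrightarrow> X = J"
    by (auto simp: P_def)
  have "maximalideal J R"
  proof (rule maximalidealI)
    show "ideal J R" by fact
    show "carrier R \<noteq> J" using J(3) by auto
  next
    fix K assume K: "ideal K R" "J \<subseteq> K" "K \<subseteq> carrier R"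
    show "K = J \<or> K = carrier R"
    proof (cases "\<one> \<in> K")
      case True
      then show ?thesis using ideal.one_imp_carrier[OF K(1)] by simp
    next
      case False
      then show ?thesis using max[of K] K J by (auto simp: P_def)
    qed
  qed
  then show thesis using that J(2) by blast
qed

text \<open>If the complement of \<open>E\<close> is not in \<open>U\<close>, no member of
  \<open>U\<close> can be disjoint from \<open>E\<close>, as it would lie inside that complement.
  Hence \<open>U\<close> and \<open>E\<close> together generate a filter, which maximality forces to
  be \<open>U\<close> itself.\<close>

lemma meas_ultrafilter_compl:
  assumes U: "meas_ultrafilter M U" and E: "E \<in> sets M" "E \<notin> U"
  shows "space M - E \<in> U"
proof (rule ccontr)
  assume n: "space M - E \<notin> U"
  have F: "meas_filter M U" using U by (simp add: meas_ultrafilter_def)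
  \<comment> \<open>The filter generated by \<open>U\<close> and \<open>E\<close>.\<close>
  define G where "G = {B \<in> sets M. \<exists>A\<in>U. A \<inter> E \<subseteq> B}"
  have "A \<inter> E \<noteq> {}" if A: "A \<in> U" for A
  proof
    assume "A \<inter> E = {}"
    moreover have "A \<subseteq> space M" using A F sets.sets_into_space by (auto simp: meas_filter_def)
    ultimately have "A \<subseteq> space M - E" by auto
    then show False using n A F E by (auto simp: meas_filter_def)
  qed
  then have "{} \<notin> G" by (auto simp: G_def)
  moreover have "B \<inter> C \<in> G" if "B \<in> G" "C \<in> G" for B C
  proof -
    from that obtain A A' where "A \<in> U" "A' \<in> U" "A \<inter> E \<subseteq> B" "A' \<inter> E \<subseteq> C" "B \<inter> C \<in> sets M"
      by (auto simp: G_def)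
    moreover from this have "A \<inter> A' \<in> U" using F by (simp add: meas_filter_def)
    moreover have "A \<inter> A' \<inter> E \<subseteq> B \<inter> C" using calculation by blast
    ultimately show ?thesis unfolding G_def by blast
  qed
  moreover have "C \<in> G" if "B \<in> G" "C \<in> sets M" "B \<subseteq> C" for B C
    using that unfolding G_def by blast
  moreover have UG: "U \<subseteq> G" using F by (auto simp: G_def meas_filter_def)
  moreover have "U \<noteq> {}" using F by (simp add: meas_filter_def)
  moreover have "G \<subseteq> sets M" by (auto simp: G_def)
  ultimately have "meas_filter M G"
    unfolding meas_filter_def by blast
  then have "G = U" using U UG by (simp add: meas_ultrafilter_def)
  moreover have "E \<in> G" using E \<open>U \<noteq> {}\<close> by (auto simp: G_def)
  ultimately show False using E by simp
qed

lemma meas_ring_simps [simp]: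
  "f \<otimes>\<^bsub>meas_ring M\<^esub> g = (\<lambda>x\<in>space M. f x * g x)"
  "f \<oplus>\<^bsub>meas_ring M\<^esub> g = (\<lambda>x\<in>space M. f x + g x)"
  "\<zero>\<^bsub>meas_ring M\<^esub> = (\<lambda>x\<in>space M. 0)"
  "\<one>\<^bsub>meas_ring M\<^esub> = (\<lambda>x\<in>space M. 1)"
  by (simp_all add: meas_ring_def)

text \<open>The functions identified with zero in the reduced power of the reals along
  \<open>F\<close>. Asking for some member of \<open>F\<close> on which \<open>f\<close> vanishes,
  instead of for the zero set of \<open>f\<close> to be in \<open>F\<close>, avoids measurability
  arguments.\<close>

definition vanishing_ideal :: "('a \<Rightarrow> real) set \<Rightarrow> 'a set set \<Rightarrow> ('a \<Rightarrow> real) set" where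
  "vanishing_ideal S F = {f \<in> S. \<exists>E\<in>F. \<forall>x\<in>E. f x = 0}"

text \<open>A sum vanishes on the intersection of the two witnessing sets, and a multiple on the
  same set as before. Properness is left to the main proof.\<close>

lemma ideal_vanishing_ideal:
  assumes S: "chi_ring M S" and F: "meas_filter M F"
  shows "ideal (vanishing_ideal S F) (chi_ring_struct M S)"
proof -
  let ?R = "chi_ring_struct M S"
  let ?J = "vanishing_ideal S F"
  interpret R: cring ?R using S by (rule cring_chi_ring_struct)
  \<comment> \<open>The ring operations return pointwise values only on \<open>space M\<close>, and
    \<open>undefined\<close> elsewhere, so the members of \<open>F\<close> must be known to lie in
    the space.\<close>
  have sp: "x \<in> space M" if "x \<in> E" "E \<in> F" for x E
    using that F sets.sets_into_space by (auto simp: meas_filter_def)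
  show ?thesis
  proof (rule idealI)
    show "ring ?R" by (rule R.ring_axioms)
    show "subgroup ?J (add_monoid ?R)"
    proof (rule group.subgroupI)
      show "group (add_monoid ?R)" by (rule R.a_group)
      show "?J \<subseteq> carrier (add_monoid ?R)" by (auto simp: vanishing_ideal_def)
      have "\<zero>\<^bsub>?R\<^esub> \<in> S" using R.zero_closed by simp
      moreover obtain E where "E \<in> F" using F by (auto simp: meas_filter_def)
      ultimately have "\<zero>\<^bsub>?R\<^esub> \<in> ?J" by (auto simp: vanishing_ideal_def sp)
      then show "?J \<noteq> {}" by blast
    next
      fix f assume f: "f \<in> ?J"
      then obtain E where fS: "f \<in> S" and E: "E \<in> F" "\<forall>x\<in>E. f x = 0"
        by (auto simp: vanishing_ideal_def)
      let ?g = "\<ominus>\<^bsub>?R\<^esub> f"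
      have gS: "?g \<in> S" using R.a_inv_closed[of f] fS by simp
      \<comment> \<open>The additive inverse is known only abstractly; evaluating this equation at a
        point of \<open>E\<close>, where \<open>f\<close> is 0, gives its value there.\<close>
      have "f \<oplus>\<^bsub>?R\<^esub> ?g = \<zero>\<^bsub>?R\<^esub>" using fS by (intro R.r_neg) simp
      then have "?g x = 0" if "x \<in> E" for x
        using that E sp[OF that E(1)] by (auto dest!: fun_cong[of _ _ x])
      then show "inv\<^bsub>add_monoid ?R\<^esub> f \<in> ?J"
        using gS E(1) by (auto simp: vanishing_ideal_def a_inv_def)
    next
      fix f g assume "f \<in> ?J" "g \<in> ?J"
      then obtain E E' where fg: "f \<in> S" "g \<in> S" "E \<in> F" "E' \<in> F"
        and "\<forall>x\<in>E. f x = 0" "\<forall>x\<in>E'. g x = 0"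
        by (auto simp: vanishing_ideal_def)
      moreover have "f \<oplus>\<^bsub>?R\<^esub> g \<in> S" using R.a_closed[of f g] fg by simp
      moreover have "E \<inter> E' \<in> F" using fg F by (auto simp: meas_filter_def)
      ultimately show "f \<otimes>\<^bsub>add_monoid ?R\<^esub> g \<in> ?J"
        by (auto simp: vanishing_ideal_def sp intro!: bexI[of _ "E \<inter> E'"])
    qed
    show "g \<otimes>\<^bsub>?R\<^esub> f \<in> ?J" if "f \<in> ?J" "g \<in> carrier ?R" for f g
      using that R.m_closed[of g f] by (auto simp: vanishing_ideal_def sp)
    show "f \<otimes>\<^bsub>?R\<^esub> g \<in> ?J" if "f \<in> ?J" "g \<in> carrier ?R" for f g
      using that R.m_closed[of f g] by (auto simp: vanishing_ideal_def sp)
  qed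
qed

theorem theorem2p7:
  fixes M :: "'a measure" and S :: "('a \<Rightarrow> real) set" and U :: "'a set set"
  assumes "space M \<noteq> {}"
    and "chi_ring M S"
    and "meas_ultrafilter M U"
  shows "\<exists>I. maximalideal I (chi_ring_struct M S) \<and> Z_ideal M S I = U"
proof -
  let ?R = "chi_ring_struct M S"
  let ?J = "vanishing_ideal S U"
  interpret R: cring ?R using assms(2) by (rule cring_chi_ring_struct)
  have U: "meas_filter M U" using assms(3) by (simp add: meas_ultrafilter_def)
  have Us: "E \<in> sets M" "E \<subseteq> space M" "E \<noteq> {}" if "E \<in> U" for E
    using that U sets.sets_into_space by (auto simp: meas_filter_def)
  have chi: "char_fun M A \<in> S" if "A \<in> sets M" for A
    using that assms(2) by (simp add: chi_ring_def)
  have chiJ: "char_fun M (space M - E) \<in> ?J" if "E \<in> U" for E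
    using that chi[of "space M - E"] Us[OF that]
    by (auto simp: vanishing_ideal_def char_fun_def intro!: bexI[of _ E])
  \<comment> \<open>Properness: the constant 1 could vanish only on the empty set, which is not in
    the filter.\<close>
  have "\<one>\<^bsub>?R\<^esub> \<notin> ?J"
  proof
    assume "\<one>\<^bsub>?R\<^esub> \<in> ?J"
    then obtain E where "E \<in> U" "\<forall>x\<in>E. (\<lambda>x\<in>space M. 1 :: real) x = 0"
      by (auto simp: vanishing_ideal_def)
    moreover from Us[OF this(1)] obtain x where "x \<in> E" "x \<in> space M" by blast
    ultimately show False by (auto dest: bspec[of _ _ x])
  qed
  then obtain I where I: "maximalideal I ?R" and JI: "?J \<subseteq> I"
    using R.exists_maximalideal_superset ideal_vanishing_ideal[OF assms(2) U] by blast
  interpret I: maximalideal I ?R by (rule I)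
  have "E \<in> U" if f: "f \<in> I" and "E \<in> Z_fun M S f" for f E
  proof (rule ccontr)
    assume "E \<notin> U"
    from \<open>E \<in> Z_fun M S f\<close> obtain g
      where E: "E \<in> sets M" and g: "g \<in> S" and fg: "\<And>x. x \<in> space M - E \<Longrightarrow> f x * g x = 1"
      by (auto simp: Z_fun_def)
    \<comment> \<open>\<open>?d\<close> is \<open>1 - c\<close>, taken as a characteristic function
      so that it is in \<open>S\<close> at once.\<close>
    let ?c = "char_fun M E" and ?d = "char_fun M (space M - E)"
    have "space M - E \<in> U" using meas_ultrafilter_compl[OF assms(3) E \<open>E \<notin> U\<close>] .
    moreover have "space M - (space M - E) = E" using sets.sets_into_space[OF E] by auto
    ultimately have c: "?c \<in> I" using chiJ[of "space M - E"] JI by auto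
    have "?d \<in> carrier ?R" using chi E by auto
    then have "?c \<oplus>\<^bsub>?R\<^esub> ((f \<otimes>\<^bsub>?R\<^esub> g) \<otimes>\<^bsub>?R\<^esub> ?d) \<in> I"
      using c f g by (intro I.a_closed I.I_r_closed) simp_all
    \<comment> \<open>On \<open>E\<close> the summands are 1 and 0; off \<open>E\<close> they are 0
      and \<open>f x * g x = 1\<close>.\<close>
    moreover have "?c \<oplus>\<^bsub>?R\<^esub> ((f \<otimes>\<^bsub>?R\<^esub> g) \<otimes>\<^bsub>?R\<^esub> ?d) = \<one>\<^bsub>?R\<^esub>"
      using fg by (auto simp: fun_eq_iff char_fun_def indicator_def)
    ultimately have "\<one>\<^bsub>?R\<^esub> \<in> I" by simp
    then show False using I.one_imp_carrier I.I_notcarr by simp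
  qed
  moreover have "E \<in> Z_fun M S (char_fun M (space M - E))" if "E \<in> U" for E
    using Us[OF that] chi[of "space M - E"]
    by (auto simp: Z_fun_def char_fun_def intro!: bexI[of _ "char_fun M (space M - E)"])
  ultimately have "Z_ideal M S I = U"
    using chiJ JI unfolding Z_ideal_def by blast
  then show ?thesis using I by blast
qed

end
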